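(* Let $G\in\mathbb{Im}^\infty$ and $n\ge 0$. Then $G=_{\mathbb{Im}^\infty}*n$ if and only if $o(G+*n)=\mathscr P$.
   Context: Affine normal play forms $\mathbb{Np}^\infty$ are defined recursively: two atomic forms $\infty$ and $\overline{\infty}$ with no options; every other form is $G=\{G^{\mathcal L}\mid G^{\mathcal R}\}$ with finite nonempty sets of previously constructed forms as Left and Right options. Followers of $G$: $G$ and followers of its options. Disjunctive sum: $\infty+X=X+\infty=\infty$ for $X\neq\overline{\infty}$; $\overline{\infty}+X=X+\overline{\infty}=\overline{\infty}$ for $X\ne\infty$; $\infty+\overline{\infty}$ undefined; otherwise $G+H=\{G^L+H,G+H^L\mid G^R+H,G+H^R\}$. Outcomes: Left wins $\infty$ and Right wins $\overline{\infty}$ whoever moves; otherwise play alternates, Left moving first wins iff some Left option is won by Left moving second, Left moving second wins iff every Right option is won by Left moving first, symmetrically for Right. $o(G)\in\{\mathscr L,\mathscr N,\mathscr P,\mathscr R\}$: Left wins either way, first player wins, second player wins, Right wins either way. Nimbers: $*0=\{\overline\infty\mid\infty\}$, $*n=\{*0,\dots,*(n-1)\mid *0,\dots,*(n-1)\}$. Conjugate $\overline G$: swaps $\infty,\overline\infty$, otherwise $\{\overline{G^R}\mid\overline{G^L}\}$. $G\notin\{\infty,\overline\infty\}$ is a check if $\infty\in G^{\mathcal L}$ or $\overline\infty\in G^{\mathcal R}$, and quiet if it is not a check. Symmetric: $G\notin\{\infty,\overline\infty\}$ and $G^{\mathcal R}=\{\overline{G^L}:G^L\in G^{\mathcal L}\}$.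 Affine impartial: symmetric and all quiet followers symmetric; the set of these is $\mathbb{Im}^\infty$. For $G,H\in\mathbb{Im}^\infty$, $G=_{\mathbb{Im}^\infty}H$ iff $o(G+X)=o(H+X)$ for all $X\in\mathbb{Im}^\infty$. *)

theory Defs
  imports Main "HOL-Library.FSet"
begin

(* The datatype also contains trees with empty option sets; np_forms below
   carves out the affine normal play forms. *)
datatype form =
    PInf    (* infinity *)
  | NInf   (* overlined infinity *)
  | Form (lopts: "form fset") (ropts: "form fset")
where
  "lopts PInf = {||}" | "lopts NInf = {||}" | "ropts PInf = {||}" | "ropts NInf = {||}"

abbreviation atomic :: "form \<Rightarrow> bool" where
  "atomic G \<equiv> G = PInf \<or> G = NInf"

inductive_set np_forms :: "form set" where
  "PInf \<in> np_forms"
| "NInf \<in> np_forms"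
| "\<lbrakk>L \<noteq> {||}; R \<noteq> {||}; \<And>X. X |\<in>| L \<Longrightarrow> X \<in> np_forms; \<And>X. X |\<in>| R \<Longrightarrow> X \<in> np_forms\<rbrakk>
    \<Longrightarrow> Form L R \<in> np_forms"

inductive_set followers :: "form \<Rightarrow> form set" for G where
  "G \<in> followers G"
| "H \<in> followers G \<Longrightarrow> K |\<in>| lopts H |\<union>| ropts H \<Longrightarrow> K \<in> followers G"

lemma size_option_less [termination_simp]:
  assumes "x |\<in>| A"
  shows "size x < Suc (n + (\<Sum>y\<in>fset A. Suc (size y)))"
    and "size x < Suc ((\<Sum>y\<in>fset A. Suc (size y)) + n)"
    and "size x < Suc (\<Sum>y\<in>fset A. Suc (size y))"
proof -
  have "Suc (size x) \<le> (\<Sum>y\<in>fset A. Suc (size y))"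
    using assms by (intro member_le_sum) auto
  then show "size x < Suc (n + (\<Sum>y\<in>fset A. Suc (size y)))"
    and "size x < Suc ((\<Sum>y\<in>fset A. Suc (size y)) + n)"
    and "size x < Suc (\<Sum>y\<in>fset A. Suc (size y))" by linarith+
qed

declare fimage_cong [fundef_cong]

(* PInf + NInf is left unspecified. That case never arises as a subterm of the
   sum of two non-atomic forms: in each recursive call at least one summand is
   non-atomic. *)
fun dsum :: "form \<Rightarrow> form \<Rightarrow> form" (infixl "\<oplus>" 65) where
  "PInf \<oplus> NInf = undefined"
| "NInf \<oplus> PInf = undefined"
| "PInf \<oplus> X = PInf"
| "X \<oplus> PInf = PInf"
| "NInf \<oplus> X = NInf"
| "X \<oplus> NInf = NInf"
| "Form GL GR \<oplus> Form HL HR =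
     Form ((\<lambda>X. X \<oplus> Form HL HR) |`| GL |\<union>| (\<lambda>Y. Form GL GR \<oplus> Y) |`| HL)
          ((\<lambda>X. X \<oplus> Form HL HR) |`| GR |\<union>| (\<lambda>Y. Form GL GR \<oplus> Y) |`| HR)"

datatype player = Left | Right

fun opponent :: "player \<Rightarrow> player" where
  "opponent Left = Right"
| "opponent Right = Left"

fun opts :: "player \<Rightarrow> form \<Rightarrow> form fset" where
  "opts Left G = lopts G"
| "opts Right G = ropts G"

(* wins p q G: player p wins G when player q is to move. *)
function wins :: "player \<Rightarrow> player \<Rightarrow> form \<Rightarrow> bool" where
  "wins p q PInf \<longleftrightarrow> p = Left"
| "wins p q NInf \<longleftrightarrow> p = Right"
| "wins p q (Form L R) \<longleftrightarrow>
     (if q = p then fBex (opts q (Form L R)) (wins p (opponent q))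
      else fBall (opts q (Form L R)) (wins p (opponent q)))"
  by pat_completeness auto
termination
proof (relation "measure (\<lambda>(p, q, G). size G)", goal_cases)
  case (2 p q L R x) then show ?case by (cases q) (auto simp: size_option_less)
next
  case (3 p q L R x) then show ?case by (cases q) (auto simp: size_option_less)
qed simp

lemma wins_opponent: "wins (opponent p) q G \<longleftrightarrow> \<not> wins p q G"
proof (induction G arbitrary: q)
  case (Form L R)
  then show ?case by (cases p; cases q) auto
qed (cases p; simp)+

datatype outcome = OL | ON | OP | OR

definition outcome :: "form \<Rightarrow> outcome" where
  "outcome G =
     (if wins Left Left G \<and> wins Left Right G then OL
      else if wins Left Left G \<and> wins Right Right G then ON
      else if wins Right Left G \<and> wins Left Right G then OP
      else OR)"

lemma outcome_iff:
  "outcome G = OL \<longleftrightarrow> wins Left Left G \<and> wins Left Right G"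
  "outcome G = ON \<longleftrightarrow> wins Left Left G \<and> wins Right Right G"
  "outcome G = OP \<longleftrightarrow> wins Right Left G \<and> wins Left Right G"
  "outcome G = OR \<longleftrightarrow> wins Right Left G \<and> wins Right Right G"
  using wins_opponent[of Left _ G] by (auto simp: outcome_def)

fun nimber :: "nat \<Rightarrow> form" where
  "nimber n =
     (if n = 0 then Form {|NInf|} {|PInf|}
      else Form (fset_of_list (map nimber [0..<n])) (fset_of_list (map nimber [0..<n])))"

declare nimber.simps [simp del]

primrec conjugate :: "form \<Rightarrow> form" where
  "conjugate PInf = NInf"
| "conjugate NInf = PInf"
| "conjugate (Form L R) = Form (conjugate |`| R) (conjugate |`| L)"

definition is_check :: "form \<Rightarrow> bool" where
  "is_check G \<longleftrightarrow> \<not> atomic G \<and> (PInf |\<in>| lopts G \<or> NInf |\<in>| ropts G)"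

definition quiet :: "form \<Rightarrow> bool" where
  "quiet G \<longleftrightarrow> \<not> atomic G \<and> \<not> is_check G"

definition symmetric :: "form \<Rightarrow> bool" where
  "symmetric G \<longleftrightarrow> \<not> atomic G \<and> ropts G = conjugate |`| lopts G"

definition Im_forms :: "form set" where
  "Im_forms = {G \<in> np_forms. symmetric G \<and> (\<forall>H\<in>followers G. quiet H \<longrightarrow> symmetric H)}"

definition Im_eq :: "form \<Rightarrow> form \<Rightarrow> bool" (infix "=\<^sub>I\<^sub>m" 50) where
  "G =\<^sub>I\<^sub>m H \<longleftrightarrow> (\<forall>X\<in>Im_forms. outcome (G \<oplus> X) = outcome (H \<oplus> X))"

end

(* A player who, moving second, wins both A and B also wins A + B by always answering
   in the summand just moved in; checks do no harm, since the reply to a check is local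
   anyway. Hence adding a P-position never changes an outcome. With N for the nimber of n,
   N + N is a P-position by copying moves, so if G + N is one too, then
   o(G + X) = o((G + X) + (N + N)) = o((G + N) + (N + X)) = o(N + X). *)
theory Submission
  imports Defs
begin

lemma opponent_opponent [simp]: "opponent (opponent p) = p"
  by (cases p) auto

lemma opponent_neq [simp]: "opponent p \<noteq> p" "p \<noteq> opponent p"
  by (cases p; simp)+

text \<open>This covers opposite infinities too, because both orders are sent to the same value
  \<open>undefined\<close>.\<close>

lemma dsum_commute: "A \<oplus> B = B \<oplus> A"
proof (induction A B rule: dsum.induct)
  case (7 GL GR HL HR)
  then show ?case
    by (simp add: sup_commute cong: fimage_cong)
qed auto

lemma atomic_dsum_Form [simp]:
  "PInf \<oplus> Form L R = PInf" "Form L R \<oplus> PInf = PInf"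
  "NInf \<oplus> Form L R = NInf" "Form L R \<oplus> NInf = NInf"
  by simp_all

text \<open>The premise keeps opposite infinities from meeting, where the sum is
  unspecified.\<close>

lemma dsum_assoc:
  assumes "PInf \<notin> {A, B, C} \<or> NInf \<notin> {A, B, C}"
  shows "A \<oplus> B \<oplus> C = A \<oplus> (B \<oplus> C)"
  using assms
proof (induction "size A + size B + size C" arbitrary: A B C rule: less_induct)
  case less
  show ?case
  proof (cases "atomic A \<or> atomic B \<or> atomic C")
    case True
    then show ?thesis using less.prems
      by (cases A; cases B; cases C) auto
  next
    case False
    then obtain AL AR BL BR CL CR
      where eq: "A = Form AL AR" "B = Form BL BR" "C = Form CL CR"
      by (metis form.exhaust)
    \<comment> \<open>Only one summand is replaced by an option and the other two are non-atomic, so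
      at most one infinity occurs and the premise survives.\<close>
    have "X \<oplus> B \<oplus> C = X \<oplus> (B \<oplus> C)" if "X |\<in>| AL |\<union>| AR" for X
      using that by (intro less.hyps) (auto simp: eq size_option_less)
    moreover have "A \<oplus> X \<oplus> C = A \<oplus> (X \<oplus> C)" if "X |\<in>| BL |\<union>| BR" for X
      using that by (intro less.hyps) (auto simp: eq size_option_less)
    moreover have "A \<oplus> B \<oplus> X = A \<oplus> (B \<oplus> X)" if "X |\<in>| CL |\<union>| CR" for X
      using that by (intro less.hyps) (auto simp: eq size_option_less)
    ultimately show ?thesis
      by (auto simp: eq fimage_funion comp_def funion_assoc
          intro!: arg_cong2[of _ _ _ _ funion] fimage_cong)
  qed
qed

lemma not_atomic_dsum: "\<not> atomic A \<Longrightarrow> \<not> atomic B \<Longrightarrow> \<not> atomic (A \<oplus> B)"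
  by (cases A; cases B) auto

text \<open>The two parts need each other: a move of the opponent in one summand turns a position
  of the first kind into one of the second kind, and the local reply turns it back.\<close>

lemma wins_dsum:
  "wins p (opponent p) A \<Longrightarrow> wins p (opponent p) B \<Longrightarrow> wins p (opponent p) (A \<oplus> B)"
  "wins p p A \<Longrightarrow> wins p (opponent p) B \<Longrightarrow> wins p p (A \<oplus> B)"
proof (induction "size A + size B" arbitrary: A B rule: less_induct)
  case less
  {
    case 1
    show ?case
    proof (cases "atomic A \<or> atomic B")
      case True
      \<comment> \<open>An atomic summand won by \<open>p\<close> is the infinity of
        \<open>p\<close>; it absorbs the other summand, which cannot be the opposite
        infinity.\<close>
      then show ?thesis using 1 by (cases A; cases B) auto
    next
      case False
      then obtain AL AR BL BR where eq: "A = Form AL AR" "B = Form BL BR"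
        by (metis form.exhaust)
      have "wins p p (X \<oplus> B)" if "X |\<in>| opts (opponent p) A" for X
        using that 1 by (intro less.hyps(2)) (cases p; auto simp: eq size_option_less)+
      \<comment> \<open>The summand just moved in is put first, where the second part expects the
        position that \<open>p\<close> wins moving first.\<close>
      moreover have "wins p p (X \<oplus> A)" if "X |\<in>| opts (opponent p) B" for X
        using that 1 by (intro less.hyps(2)) (cases p; auto simp: eq size_option_less)+
      ultimately show ?thesis
        by (cases p) (auto simp: eq dsum_commute[of "Form AL AR"])
    qed
  next
    case 2
    show ?case
    proof (cases "atomic A \<or> atomic B")
      case True
      then show ?thesis using 2 by (cases A; cases B) auto
    next
      case False
      then obtain AL AR BL BR where eq: "A = Form AL AR" "B = Form BL BR"
        by (metis form.exhaust)
      from 2 obtain X where X: "X |\<in>| opts p A" "wins p (opponent p) X"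
        by (auto simp: eq)
      have "wins p (opponent p) (X \<oplus> B)"
        using X 2 by (intro less.hyps(1)) (cases p; auto simp: eq size_option_less)+
      then show ?thesis using X by (cases p) (auto simp: eq)
    qed
  }
qed

text \<open>One direction suffices: exactly one player wins, so the implication for the opponent is
  the converse.\<close>

lemma outcome_eqI:
  assumes "\<And>p q. wins p q A \<Longrightarrow> wins p q B"
  shows "outcome A = outcome B"
proof -
  have "wins p q A \<longleftrightarrow> wins p q B" for p q
    using assms[of p q] assms[of "opponent p" q] by (auto simp: wins_opponent)
  then show ?thesis by (simp add: outcome_def)
qed

lemma outcome_OP_iff: "outcome G = OP \<longleftrightarrow> (\<forall>p. wins p (opponent p) G)"
  by (metis opponent.simps outcome_iff(3) player.exhaust)

lemma outcome_dsum_OP: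
  assumes "outcome G = OP"
  shows "outcome (X \<oplus> G) = outcome X"
proof (rule outcome_eqI[symmetric])
  fix p q assume "wins p q X"
  moreover have "q = p \<or> q = opponent p" by (cases p; cases q) auto
  ultimately show "wins p q (X \<oplus> G)"
    using assms by (auto simp: outcome_OP_iff wins_dsum)
qed

lemma nimber_0: "nimber 0 = Form {|NInf|} {|PInf|}"
  by (simp add: nimber.simps)

lemma nimber_pos:
  "n > 0 \<Longrightarrow> nimber n = Form (fset_of_list (map nimber [0..<n])) (fset_of_list (map nimber [0..<n]))"
  by (subst nimber.simps) simp

lemma fmember_nimbers_iff [simp]:
  "X |\<in>| fset_of_list (map nimber [0..<n]) \<longleftrightarrow> (\<exists>k<n. X = nimber k)"
  by (auto simp: fset_of_list_elem)

lemma not_atomic_nimber: "\<not> atomic (nimber n)"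
  by (subst (1 2) nimber.simps) simp

text \<open>The case 0 is excluded because the options of \<open>nimber 0\<close> are the
  infinities.\<close>

lemma opts_nimber_pos: "n > 0 \<Longrightarrow> X |\<in>| opts p (nimber n) \<longleftrightarrow> (\<exists>k<n. X = nimber k)"
  by (cases p) (simp_all only: nimber_pos opts.simps form.sel fmember_nimbers_iff)

lemma wins_Form_iff:
  assumes "\<not> atomic G"
  shows "wins p p G \<longleftrightarrow> (\<exists>X. X |\<in>| opts p G \<and> wins p (opponent p) X)"
    and "wins p (opponent p) G \<longleftrightarrow> (\<forall>X. X |\<in>| opts (opponent p) G \<longrightarrow> wins p p X)"
  using assms by (cases G; auto)+

lemma opts_dsum:
  assumes "\<not> atomic G" "\<not> atomic H"
  shows "opts p (G \<oplus> H) = (\<lambda>X. X \<oplus> H) |`| opts p G |\<union>| (\<lambda>Y. G \<oplus> Y) |`| opts p H"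
  using assms by (cases G; cases H; cases p) auto

lemma outcome_nimber_dsum_nimber: "outcome (nimber n \<oplus> nimber n) = OP"
proof -
  have "wins p (opponent p) (nimber n \<oplus> nimber n)" for p
  proof (induction n rule: less_induct)
    case (less n)
    show ?case
    proof (cases "n = 0")
      case True
      \<comment> \<open>Every first move produces the infinity of the other player, which absorbs
        the remaining summand.\<close>
      then show ?thesis by (cases p) (auto simp: nimber_0)
    next
      case False
      have reply: "wins p p (nimber k \<oplus> nimber n)" if "k < n" for k
      proof -
        \<comment> \<open>This is the copying reply; the induction hypothesis applies to it.\<close>
        have "nimber k \<oplus> nimber k |\<in>| opts p (nimber k \<oplus> nimber n)"
          using that False opts_nimber_pos[of n "nimber k" p]
          by (auto simp: opts_dsum not_atomic_nimber)
        then show ?thesis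
          using less[OF that] by (auto simp: wins_Form_iff not_atomic_dsum not_atomic_nimber)
      qed
      then have "wins p p (nimber n \<oplus> nimber k)" if "k < n" for k
        using that by (simp add: dsum_commute)
      with reply show ?thesis
        using False
        by (auto simp: wins_Form_iff(2) not_atomic_dsum not_atomic_nimber opts_dsum opts_nimber_pos)
    qed
  qed
  then show ?thesis by (simp add: outcome_OP_iff)
qed

lemma nimber_in_np_forms: "nimber n \<in> np_forms"
proof (induction n rule: less_induct)
  case (less n)
  show ?case
  proof (cases "n = 0")
    case True
    then show ?thesis by (auto simp: nimber_0 intro!: np_forms.intros)
  next
    case False
    then have "nimber 0 |\<in>| fset_of_list (map nimber [0..<n])"
      by (auto simp del: fset_of_list_map)
    then have "fset_of_list (map nimber [0..<n]) \<noteq> {||}" by blast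
    then show ?thesis
      using less False by (subst nimber_pos) (auto simp del: fset_of_list_map intro!: np_forms.intros)
  qed
qed

lemma conjugate_nimber: "conjugate (nimber n) = nimber n"
proof (induction n rule: less_induct)
  case (less n)
  show ?case
  proof (cases "n = 0")
    case False
    have "conjugate |`| fset_of_list (map nimber [0..<n]) = fset_of_list (map nimber [0..<n])"
      using less by (auto simp flip: fset_of_list_map simp: fset_of_list_elem)
    with False show ?thesis by (simp only: nimber_pos conjugate.simps)
  qed (simp add: nimber_0)
qed

text \<open>Symmetry is the right-option component of the equation between a form and its
  conjugate.\<close>

lemma symmetric_nimber: "symmetric (nimber n)"
proof -
  have "conjugate (nimber n) = nimber n" by (rule conjugate_nimber)
  then show ?thesis
    using not_atomic_nimber[of n] by (cases "nimber n") (auto simp: symmetric_def)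
qed

text \<open>Atomic followers are not quiet, so only nimbers have to be checked for symmetry.\<close>

lemma followers_nimber:
  assumes "H \<in> followers (nimber n)"
  shows "atomic H \<or> (\<exists>k. H = nimber k)"
  using assms
proof induction
  case (2 H K)
  from "2.IH" consider "atomic H" | "H = nimber 0" | k where "k > 0" "H = nimber k"
    by (metis gr0I)
  then show ?case
  proof cases
    case 3
    then show ?thesis
      using "2.hyps"(2) opts_nimber_pos[of k K Left] opts_nimber_pos[of k K Right] by auto
  qed (use "2.hyps"(2) in \<open>auto simp: nimber_0\<close>)
qed blast

lemma nimber_in_Im_forms: "nimber n \<in> Im_forms"
  using followers_nimber nimber_in_np_forms symmetric_nimber
  by (fastforce simp: Im_forms_def quiet_def)

theorem theorem3p6:
  fixes G :: form and n :: nat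
  assumes "G \<in> Im_forms"
  shows "G =\<^sub>I\<^sub>m nimber n \<longleftrightarrow> outcome (G \<oplus> nimber n) = OP"
proof
  assume "G =\<^sub>I\<^sub>m nimber n"
  \<comment> \<open>The test form is \<open>nimber n\<close> itself, which turns the right side into
    the P-position \<open>nimber n \<oplus> nimber n\<close>.\<close>
  then show "outcome (G \<oplus> nimber n) = OP"
    using nimber_in_Im_forms outcome_nimber_dsum_nimber by (simp add: Im_eq_def)
next
  assume OP: "outcome (G \<oplus> nimber n) = OP"
  let ?N = "nimber n"
  have "outcome (G \<oplus> X) = outcome (?N \<oplus> X)" if "X \<in> Im_forms" for X
  proof -
    have na: "\<not> atomic G" "\<not> atomic X" "\<not> atomic ?N"
      using assms that not_atomic_nimber by (auto simp: Im_forms_def symmetric_def)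
    \<comment> \<open>Non-atomic partial sums guarantee the premise of \<open>dsum_assoc\<close> in
      each regrouping below.\<close>
    have na2: "\<not> atomic (?N \<oplus> ?N)" "\<not> atomic (G \<oplus> ?N)" "\<not> atomic (?N \<oplus> X)"
      using na not_atomic_dsum by blast+
    have "G \<oplus> X \<oplus> (?N \<oplus> ?N) = G \<oplus> (X \<oplus> (?N \<oplus> ?N))"
      by (rule dsum_assoc) (use na na2 in auto)
    also have "X \<oplus> (?N \<oplus> ?N) = ?N \<oplus> (?N \<oplus> X)"
      by (subst dsum_commute, rule dsum_assoc) (use na in auto)
    also have "G \<oplus> (?N \<oplus> (?N \<oplus> X)) = G \<oplus> ?N \<oplus> (?N \<oplus> X)"
      by (rule dsum_assoc[symmetric]) (use na na2 in auto)
    also have "\<dots> = ?N \<oplus> X \<oplus> (G \<oplus> ?N)"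
      by (rule dsum_commute)
    finally show ?thesis
      using outcome_dsum_OP[OF OP] outcome_dsum_OP[OF outcome_nimber_dsum_nimber] by metis
  qed
  then show "G =\<^sub>I\<^sub>m ?N" by (simp add: Im_eq_def)
qed

end
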